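(* Let $\alpha>0$, $\alpha\ne1$, and for $\mu>0$ let $p_1(x)=\mu^{-1}e^{-x/\mu}$ for $x\ge0$ and $p_1(x)=0$ for $x<0$ be the exponential density with mean $\mu$. Put $$\mathcal H_\alpha^{(1)}(\mu)=\frac{1}{|1-\alpha|}\left|\log\int_{\mathbb R}p_1^\alpha(x)\,dx\right|,\quad \mathcal H_\alpha^{(2)}(\mu)=\frac{1}{|1-\alpha|}\left(\log\int_{\mathbb R}p_1^\alpha(x)\,dx\right)_+,$$ $$\mathcal H_\alpha^{(3)}(\mu)=\frac{1}{|1-\alpha|}\log\left(\int_{\mathbb R}p_1^\alpha(x)\,dx+1\right),$$ and define $\mu_\alpha:=\alpha^{1/(1-\alpha)}$. Then: 1) For any $\alpha\in(0,1)\cup(1,+\infty)$, $$\mathcal H_\alpha^{(1)}(\mu)=\begin{cases}-\log\mu+\frac{\log\alpha}{1-\alpha},&\text{if }\mu\le\mu_\alpha,\\ \log\mu-\frac{\log\alpha}{1-\alpha},&\text{if }\mu>\mu_\alpha.\end{cases}$$ The function $\mathcal H_\alpha^{(1)}$ decreases from $+\infty$ to $0$ as $\mu$ increases from $0$ to $\mu_\alpha$, and increases from $0$ to $+\infty$ as $\mu$ increases from $\mu_\alpha$ to $+\infty$. 2) If $\alpha\in(0,1)$, then $$\mathcal H_\alpha^{(2)}(\mu)=\begin{cases}0,&\text{if }\mu\le\mu_\alpha,\\ \log\mu-\frac{\log\alpha}{1-\alpha},&\text{if }\mu>\mu_\alpha,\end{cases}$$ and $\mathcal H_\alpha^{(2)}$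 increases from $0$ to $+\infty$ as $\mu$ increases from $\mu_\alpha$ to $+\infty$. If $\alpha>1$, then $$\mathcal H_\alpha^{(2)}(\mu)=\begin{cases}-\log\mu+\frac{\log\alpha}{1-\alpha},&\text{if }\mu\le\mu_\alpha,\\ 0,&\text{if }\mu>\mu_\alpha,\end{cases}$$ and $\mathcal H_\alpha^{(2)}$ decreases from $+\infty$ to $0$ as $\mu$ increases from $0$ to $\mu_\alpha$. 3) For any $\alpha\in(0,1)\cup(1,+\infty)$, $$\mathcal H_\alpha^{(3)}(\mu)=\frac{1}{|1-\alpha|}\log\left(\mu^{1-\alpha}\alpha^{-1}+1\right).$$ If $\alpha\in(0,1)$, then $\mathcal H_\alpha^{(3)}$ increases from $0$ to $+\infty$ as $\mu$ increases from $0$ to $+\infty$. If $\alpha>1$, then $\mathcal H_\alpha^{(3)}$ decreases from $+\infty$ to $0$ as $\mu$ increases from $0$ to $+\infty$.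
   Context: $\log$ is the natural logarithm and $a_+=\max(a,0)$. Phrases such as "decreases from $+\infty$ to $0$ as $\mu$ increases from $0$ to $\mu_\alpha$" mean monotonicity on the indicated interval, with the stated values being attained at, or being the limits at, the endpoints. The functionals $\mathcal H_\alpha^{(i)}$ are the alternative Rényi entropies $\mathcal H_{R,\alpha}^{(i)}$ evaluated at the density $p_1$ and regarded as functions of $\mu$. *)

theory Defs
  imports "HOL-Probability.Probability"
begin

text \<open>The three alternative Renyi entropies of order \<alpha> of a density p on the real line.
  Since 0 powr \<alpha> = 0, points where p vanishes do not contribute to the integral.\<close>

definition alt_renyi1 :: "real \<Rightarrow> (real \<Rightarrow> real) \<Rightarrow> real" where
  "alt_renyi1 \<alpha> p = 1 / \<bar>1 - \<alpha>\<bar> * \<bar>ln (LINT x|lborel. p x powr \<alpha>)\<bar>"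

definition alt_renyi2 :: "real \<Rightarrow> (real \<Rightarrow> real) \<Rightarrow> real" where
  "alt_renyi2 \<alpha> p = 1 / \<bar>1 - \<alpha>\<bar> * max (ln (LINT x|lborel. p x powr \<alpha>)) 0"

definition alt_renyi3 :: "real \<Rightarrow> (real \<Rightarrow> real) \<Rightarrow> real" where
  "alt_renyi3 \<alpha> p = 1 / \<bar>1 - \<alpha>\<bar> * ln ((LINT x|lborel. p x powr \<alpha>) + 1)"

text \<open>The exponential density parametrised by its mean (the library uses the rate).\<close>

definition p1 :: "real \<Rightarrow> real \<Rightarrow> real" where
  "p1 \<mu> = exponential_density (1 / \<mu>)"

lemma p1_eq: "p1 \<mu> x = (if x \<ge> 0 then 1 / \<mu> * exp (- x / \<mu>) else 0)"
  by (simp add: p1_def exponential_density_def)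

definition H1 :: "real \<Rightarrow> real \<Rightarrow> real" where
  "H1 \<alpha> \<mu> = alt_renyi1 \<alpha> (p1 \<mu>)"

definition H2 :: "real \<Rightarrow> real \<Rightarrow> real" where
  "H2 \<alpha> \<mu> = alt_renyi2 \<alpha> (p1 \<mu>)"

definition H3 :: "real \<Rightarrow> real \<Rightarrow> real" where
  "H3 \<alpha> \<mu> = alt_renyi3 \<alpha> (p1 \<mu>)"

definition mu_crit :: "real \<Rightarrow> real" where
  "mu_crit \<alpha> = \<alpha> powr (1 / (1 - \<alpha>))"

end

theory Submission
  imports Defs "HOL-Real_Asymp.Real_Asymp"
begin

text \<open>
  Every claim reduces to one integral. The power \<open>p\<^sub>1\<^sup>\<alpha>\<close> vanishes for \<open>x < 0\<close> and is proportional to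
  \<open>exp (- \<alpha> x / \<mu>)\<close> for \<open>x \<ge> 0\<close>, so it is a constant multiple of the exponential density of rate \<open>\<alpha> / \<mu>\<close>, and its integral is the
  constant, \<open>\<mu>\<^bsup>1-\<alpha>\<^esup> / \<alpha>\<close> (\<open>integral_p1_powr\<close>). The critical mean \<open>\<mu>\<^sub>\<alpha>\<close> is exactly the mean at
  which this integral equals \<open>1\<close>, and around it the logarithm of the integral takes the form
  \<open>(1 - \<alpha>) (ln \<mu> - ln \<mu>\<^sub>\<alpha>)\<close> (\<open>ln_integral_p1_powr\<close>).

  Dividing by \<open>\<bar>1 - \<alpha>\<bar>\<close> cancels the factor \<open>1 - \<alpha>\<close> up to its sign. The first entropy is therefore
  the distance between \<open>ln \<mu>\<close> and \<open>ln \<mu>\<^sub>\<alpha>\<close>, whatever \<open>\<alpha>\<close> is. The second is the positive part of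
  \<open>ln \<mu> - ln \<mu>\<^sub>\<alpha>\<close> or of its negative, according to the sign of \<open>1 - \<alpha>\<close>. Their monotonicity
  and limits are those of the logarithm. The third entropy is a positive multiple of \<open>ln (I + 1)\<close>,
  where \<open>I\<close> is the integral; since \<open>ln (I + 1)\<close> is an increasing function of \<open>I\<close> mapping the range from
  \<open>0\<close> to \<open>\<infinity>\<close> onto itself, it inherits the behaviour of the power function \<open>\<mu>\<^bsup>1-\<alpha>\<^esup>\<close>, which
  increases for \<open>\<alpha> < 1\<close> and decreases for \<open>\<alpha> > 1\<close>.
\<close>

text \<open>The density of rate \<open>\<alpha> / \<mu>\<close> has leading factor \<open>\<alpha> / \<mu>\<close> while \<open>p\<^sub>1\<^sup>\<alpha>\<close> has \<open>\<mu>\<^bsup>-\<alpha>\<^esup>\<close>;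
  the quotient of the two is the integral, because a density has total mass \<open>1\<close>.\<close>

lemma p1_powr_eq:
  assumes "\<alpha> > 0" and "\<mu> > 0"
  shows "p1 \<mu> x powr \<alpha> = \<mu> powr (1 - \<alpha>) * inverse \<alpha> * exponential_density (\<alpha> / \<mu>) x"
proof (cases "x < 0")
  case True
  then show ?thesis
    using assms by (simp add: p1_def exponential_density_def)
next
  case False
  have "p1 \<mu> x powr \<alpha> = (1 / \<mu>) powr \<alpha> * exp (- x / \<mu>) powr \<alpha>"
    using False assms by (simp add: p1_eq powr_mult [symmetric])
  also have "exp (- x / \<mu>) powr \<alpha> = exp (- x * (\<alpha> / \<mu>))"
    by (simp add: exp_powr_real)
  also have "(1 / \<mu>) powr \<alpha> = \<mu> powr (1 - \<alpha>) * inverse \<alpha> * (\<alpha> / \<mu>)"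
    using assms by (simp add: powr_divide powr_diff field_simps)
  finally show ?thesis
    using False by (simp add: exponential_density_def)
qed

lemma integral_p1_powr:
  assumes "\<alpha> > 0" and "\<mu> > 0"
  shows "(LINT x|lborel. p1 \<mu> x powr \<alpha>) = \<mu> powr (1 - \<alpha>) * inverse \<alpha>"
proof -
  \<comment> \<open>The zeroth moment of the Erlang density of shape \<open>0\<close> is the total mass of the exponential density.\<close>
  have "(\<integral>\<^sup>+ x. ennreal (exponential_density (\<alpha> / \<mu>) x) \<partial>lborel) = 1"
    using nn_integral_erlang_ith_moment [of "\<alpha> / \<mu>" 0 0] assms by simp
  then have "(LINT x|lborel. exponential_density (\<alpha> / \<mu>) x) = 1"
    using assms by (subst integral_eq_nn_integral) (auto intro: erlang_density_nonneg)
  then show ?thesis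
    using assms by (simp add: p1_powr_eq)
qed

lemma mu_crit_pos: "\<alpha> > 0 \<Longrightarrow> mu_crit \<alpha> > 0"
  by (simp add: mu_crit_def)

lemma ln_mu_crit: "\<alpha> > 0 \<Longrightarrow> ln (mu_crit \<alpha>) = ln \<alpha> / (1 - \<alpha>)"
  by (simp add: mu_crit_def ln_powr)

lemma ln_integral_p1_powr:
  assumes "\<alpha> > 0" and "\<alpha> \<noteq> 1" and "\<mu> > 0"
  shows "ln (LINT x|lborel. p1 \<mu> x powr \<alpha>) = (1 - \<alpha>) * (ln \<mu> - ln (mu_crit \<alpha>))"
proof -
  have "ln (LINT x|lborel. p1 \<mu> x powr \<alpha>) = (1 - \<alpha>) * ln \<mu> - ln \<alpha>"
    using assms by (simp add: integral_p1_powr ln_mult ln_inverse ln_powr)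
  also have "\<dots> = (1 - \<alpha>) * (ln \<mu> - ln (mu_crit \<alpha>))"
    using assms by (simp add: ln_mu_crit right_diff_distrib)
  finally show ?thesis .
qed

lemma H1_eq:
  assumes "\<alpha> > 0" and "\<alpha> \<noteq> 1" and "\<mu> > 0"
  shows "H1 \<alpha> \<mu> = \<bar>ln \<mu> - ln (mu_crit \<alpha>)\<bar>"
  using assms by (simp add: H1_def alt_renyi1_def ln_integral_p1_powr abs_mult)

lemma H2_eq_of_less_1:
  assumes "\<alpha> > 0" and "\<alpha> < 1" and "\<mu> > 0"
  shows "H2 \<alpha> \<mu> = max (ln \<mu> - ln (mu_crit \<alpha>)) 0"
  using assms by (simp add: H2_def alt_renyi2_def ln_integral_p1_powr max_def zero_le_mult_iff mult_le_0_iff)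

lemma H2_eq_of_greater_1:
  assumes "\<alpha> > 1" and "\<mu> > 0"
  shows "H2 \<alpha> \<mu> = max (ln (mu_crit \<alpha>) - ln \<mu>) 0"
proof -
  have "max ((1 - \<alpha>) * (ln \<mu> - ln (mu_crit \<alpha>))) 0 = (\<alpha> - 1) * max (ln (mu_crit \<alpha>) - ln \<mu>) 0"
    using assms(1) by (simp add: max_mult_distrib_left algebra_simps)
  then show ?thesis
    using assms by (simp add: H2_def alt_renyi2_def ln_integral_p1_powr)
qed

lemma H3_eq:
  assumes "\<alpha> > 0" and "\<mu> > 0"
  shows "H3 \<alpha> \<mu> = 1 / \<bar>1 - \<alpha>\<bar> * ln (\<mu> powr (1 - \<alpha>) * inverse \<alpha> + 1)"
  using assms by (simp add: H3_def alt_renyi3_def integral_p1_powr)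

text \<open>The critical mean cuts the half-line into two parts on which \<open>ln \<mu> - ln \<mu>\<^sub>\<alpha>\<close> has a constant
  sign. On each part the first two entropies, where they are not zero throughout, are this
  difference or its negative, so the next two lemmas apply with \<open>m = \<mu>\<^sub>\<alpha>\<close> and \<open>c = ln \<mu>\<^sub>\<alpha>\<close>.\<close>

lemma strict_antimono_on_of_eq_minus_ln:
  fixes f :: "real \<Rightarrow> real"
  assumes "\<And>\<mu>. 0 < \<mu> \<Longrightarrow> \<mu> \<le> m \<Longrightarrow> f \<mu> = c - ln \<mu>"
  shows "strict_antimono_on {0<..m} f"
  using assms by (simp add: monotone_on_def)

lemma strict_mono_on_of_eq_ln_minus:
  fixes f :: "real \<Rightarrow> real"
  assumes "m > 0" and "\<And>\<mu>. m \<le> \<mu> \<Longrightarrow> f \<mu> = ln \<mu> - c"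
  shows "strict_mono_on {m..} f"
  using assms by (simp add: monotone_on_def)

text \<open>The absolute value and the positive part both dominate their argument, so the first two
  entropies diverge, at the ends where that argument does, by comparison with the logarithm.\<close>

lemma filterlim_at_top_of_ln_minus_le:
  fixes f :: "real \<Rightarrow> real"
  assumes "\<And>\<mu>. 0 < \<mu> \<Longrightarrow> ln \<mu> - c \<le> f \<mu>"
  shows "filterlim f at_top at_top"
proof (rule filterlim_at_top_mono)
  show "filterlim (\<lambda>\<mu>. ln \<mu> - c) at_top at_top"
    by real_asymp
  show "eventually (\<lambda>\<mu>. ln \<mu> - c \<le> f \<mu>) at_top"
    using eventually_gt_at_top [of 0] by eventually_elim (rule assms)
qed

lemma filterlim_at_right_0_of_minus_ln_le:
  fixes f :: "real \<Rightarrow> real"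
  assumes "\<And>\<mu>. 0 < \<mu> \<Longrightarrow> c - ln \<mu> \<le> f \<mu>"
  shows "filterlim f at_top (at_right 0)"
proof (rule filterlim_at_top_mono)
  show "filterlim (\<lambda>\<mu>::real. c - ln \<mu>) at_top (at_right 0)"
    by real_asymp
  show "eventually (\<lambda>\<mu>. c - ln \<mu> \<le> f \<mu>) (at_right 0)"
    using eventually_at_right_less [of 0] by eventually_elim (rule assms)
qed

text \<open>Both monotonicity claims about the third entropy come from this comparison: the sign of \<open>1 - \<alpha>\<close>
  decides whether the smaller or the larger mean has the smaller power.\<close>

lemma H3_less_of_powr_less:
  assumes "\<alpha> > 0" and "\<alpha> \<noteq> 1" and "x > 0" and "y > 0"
    and less: "x powr (1 - \<alpha>) < y powr (1 - \<alpha>)"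
  shows "H3 \<alpha> x < H3 \<alpha> y"
proof -
  have "x powr (1 - \<alpha>) * inverse \<alpha> < y powr (1 - \<alpha>) * inverse \<alpha>"
    using assms by (intro mult_strict_right_mono) auto
  moreover have "0 \<le> x powr (1 - \<alpha>) * inverse \<alpha>"
    using assms by simp
  ultimately have "ln (x powr (1 - \<alpha>) * inverse \<alpha> + 1) < ln (y powr (1 - \<alpha>) * inverse \<alpha> + 1)"
    by simp
  then have "1 / \<bar>1 - \<alpha>\<bar> * ln (x powr (1 - \<alpha>) * inverse \<alpha> + 1)
      < 1 / \<bar>1 - \<alpha>\<bar> * ln (y powr (1 - \<alpha>) * inverse \<alpha> + 1)"
    using assms(2) by (intro mult_strict_left_mono) auto
  then show ?thesis
    using assms by (simp only: H3_eq)
qed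

text \<open>At nonpositive \<open>\<mu>\<close> the function \<open>p1 \<mu>\<close> is not a density and the closed form may fail, so
  limits are transferred along filters that eventually avoid these values.\<close>

lemma filterlim_H3_iff:
  assumes "\<alpha> > 0" and "eventually (\<lambda>\<mu>. 0 < \<mu>) G"
  shows "filterlim (H3 \<alpha>) F G \<longleftrightarrow>
    filterlim (\<lambda>\<mu>. 1 / \<bar>1 - \<alpha>\<bar> * ln (\<mu> powr (1 - \<alpha>) * inverse \<alpha> + 1)) F G"
proof (intro filterlim_cong refl)
  show "eventually (\<lambda>\<mu>. H3 \<alpha> \<mu> = 1 / \<bar>1 - \<alpha>\<bar> * ln (\<mu> powr (1 - \<alpha>) * inverse \<alpha> + 1)) G"
    using assms(2) by eventually_elim (rule H3_eq [OF assms(1)])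
qed

lemma H3_of_less_1:
  assumes "\<alpha> > 0" and "\<alpha> < 1"
  shows "strict_mono_on {0<..} (H3 \<alpha>)"
    and "(H3 \<alpha> \<longlongrightarrow> 0) (at_right 0)"
    and "filterlim (H3 \<alpha>) at_top at_top"
proof -
  show "strict_mono_on {0<..} (H3 \<alpha>)"
    using assms by (intro monotone_onI H3_less_of_powr_less) (auto intro: powr_less_mono2)
  show "(H3 \<alpha> \<longlongrightarrow> 0) (at_right 0)"
    unfolding filterlim_H3_iff [OF assms(1) eventually_at_right_less] using assms by real_asymp
  show "filterlim (H3 \<alpha>) at_top at_top"
    unfolding filterlim_H3_iff [OF assms(1) eventually_gt_at_top] using assms by real_asymp
qed

lemma H3_of_greater_1:
  assumes "\<alpha> > 1"
  shows "strict_antimono_on {0<..} (H3 \<alpha>)"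
    and "filterlim (H3 \<alpha>) at_top (at_right 0)"
    and "(H3 \<alpha> \<longlongrightarrow> 0) at_top"
proof -
  have pos: "\<alpha> > 0"
    using assms by simp
  show "strict_antimono_on {0<..} (H3 \<alpha>)"
    using assms by (intro monotone_onI H3_less_of_powr_less) (auto intro: powr_less_mono2_neg)
  show "filterlim (H3 \<alpha>) at_top (at_right 0)"
    unfolding filterlim_H3_iff [OF pos eventually_at_right_less] using assms pos by real_asymp
  show "(H3 \<alpha> \<longlongrightarrow> 0) at_top"
    unfolding filterlim_H3_iff [OF pos eventually_gt_at_top] using assms pos by real_asymp
qed

theorem proposition4:
  fixes \<alpha> :: real
  assumes "\<alpha> > 0" and "\<alpha> \<noteq> 1"
  shows
    "((\<forall>\<mu>>0. H1 \<alpha> \<mu> = (if \<mu> \<le> mu_crit \<alpha> then - ln \<mu> + ln \<alpha> / (1 - \<alpha>)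
                                         else ln \<mu> - ln \<alpha> / (1 - \<alpha>)))
     \<and> strict_antimono_on {0<..mu_crit \<alpha>} (H1 \<alpha>)
     \<and> filterlim (H1 \<alpha>) at_top (at_right 0)
     \<and> H1 \<alpha> (mu_crit \<alpha>) = 0
     \<and> strict_mono_on {mu_crit \<alpha>..} (H1 \<alpha>)
     \<and> filterlim (H1 \<alpha>) at_top at_top)
     \<and> (\<alpha> < 1 \<longrightarrow>
       (\<forall>\<mu>>0. H2 \<alpha> \<mu> = (if \<mu> \<le> mu_crit \<alpha> then 0 else ln \<mu> - ln \<alpha> / (1 - \<alpha>)))
       \<and> H2 \<alpha> (mu_crit \<alpha>) = 0
       \<and> strict_mono_on {mu_crit \<alpha>..} (H2 \<alpha>)
       \<and> filterlim (H2 \<alpha>) at_top at_top)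
     \<and> (\<alpha> > 1 \<longrightarrow>
       (\<forall>\<mu>>0. H2 \<alpha> \<mu> = (if \<mu> \<le> mu_crit \<alpha> then - ln \<mu> + ln \<alpha> / (1 - \<alpha>) else 0))
       \<and> strict_antimono_on {0<..mu_crit \<alpha>} (H2 \<alpha>)
       \<and> filterlim (H2 \<alpha>) at_top (at_right 0)
       \<and> H2 \<alpha> (mu_crit \<alpha>) = 0)
     \<and> (\<forall>\<mu>>0. H3 \<alpha> \<mu> = 1 / \<bar>1 - \<alpha>\<bar> * ln (\<mu> powr (1 - \<alpha>) * inverse \<alpha> + 1))
     \<and> (\<alpha> < 1 \<longrightarrow>
       strict_mono_on {0<..} (H3 \<alpha>)
       \<and> (H3 \<alpha> \<longlongrightarrow> 0) (at_right 0)
       \<and> filterlim (H3 \<alpha>) at_top at_top)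
     \<and> (\<alpha> > 1 \<longrightarrow>
       strict_antimono_on {0<..} (H3 \<alpha>)
       \<and> filterlim (H3 \<alpha>) at_top (at_right 0)
       \<and> (H3 \<alpha> \<longlongrightarrow> 0) at_top)"
proof (intro conjI impI)
  let ?m = "mu_crit \<alpha>"
  note m_pos = mu_crit_pos [OF \<open>\<alpha> > 0\<close>]
  note m_ln = ln_mu_crit [OF \<open>\<alpha> > 0\<close>]
  note H1 = H1_eq [OF \<open>\<alpha> > 0\<close> \<open>\<alpha> \<noteq> 1\<close>]
  have le_iff: "\<mu> \<le> ?m \<longleftrightarrow> ln \<mu> \<le> ln ?m" if "\<mu> > 0" for \<mu>
    using that m_pos by simp
  show "\<forall>\<mu>>0. H1 \<alpha> \<mu> = (if \<mu> \<le> ?m then - ln \<mu> + ln \<alpha> / (1 - \<alpha>) else ln \<mu> - ln \<alpha> / (1 - \<alpha>))"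
    by (auto simp: H1 le_iff m_ln [symmetric] simp del: ln_le_cancel_iff)
  show "strict_antimono_on {0<..?m} (H1 \<alpha>)"
    by (rule strict_antimono_on_of_eq_minus_ln [where c = "ln ?m"]) (simp add: H1 m_pos)
  show "strict_mono_on {?m..} (H1 \<alpha>)"
    by (rule strict_mono_on_of_eq_ln_minus [where c = "ln ?m"]) (use m_pos in \<open>auto simp: H1\<close>)
  show "filterlim (H1 \<alpha>) at_top (at_right 0)"
    by (rule filterlim_at_right_0_of_minus_ln_le [where c = "ln ?m"]) (simp add: H1)
  show "filterlim (H1 \<alpha>) at_top at_top"
    by (rule filterlim_at_top_of_ln_minus_le [where c = "ln ?m"]) (simp add: H1)
  show "H1 \<alpha> ?m = 0"
    using H1 [OF m_pos] by simp
  show "\<forall>\<mu>>0. H3 \<alpha> \<mu> = 1 / \<bar>1 - \<alpha>\<bar> * ln (\<mu> powr (1 - \<alpha>) * inverse \<alpha> + 1)"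
    using H3_eq [OF \<open>\<alpha> > 0\<close>] by blast
  {
    assume "\<alpha> < 1"
    note H2 = H2_eq_of_less_1 [OF \<open>\<alpha> > 0\<close> this]
    show "\<forall>\<mu>>0. H2 \<alpha> \<mu> = (if \<mu> \<le> ?m then 0 else ln \<mu> - ln \<alpha> / (1 - \<alpha>))"
      by (auto simp: H2 le_iff m_ln [symmetric] simp del: ln_le_cancel_iff)
    show "H2 \<alpha> ?m = 0"
      using H2 [OF m_pos] by simp
    show "strict_mono_on {?m..} (H2 \<alpha>)"
      by (rule strict_mono_on_of_eq_ln_minus [where c = "ln ?m"]) (use m_pos in \<open>auto simp: H2\<close>)
    show "filterlim (H2 \<alpha>) at_top at_top"
      by (rule filterlim_at_top_of_ln_minus_le [where c = "ln ?m"]) (simp add: H2)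
    show "strict_mono_on {0<..} (H3 \<alpha>)" "(H3 \<alpha> \<longlongrightarrow> 0) (at_right 0)"
      "filterlim (H3 \<alpha>) at_top at_top"
      using H3_of_less_1 [OF \<open>\<alpha> > 0\<close> \<open>\<alpha> < 1\<close>] by blast+
  }
  {
    assume "\<alpha> > 1"
    note H2 = H2_eq_of_greater_1 [OF this]
    show "\<forall>\<mu>>0. H2 \<alpha> \<mu> = (if \<mu> \<le> ?m then - ln \<mu> + ln \<alpha> / (1 - \<alpha>) else 0)"
      by (auto simp: H2 le_iff m_ln [symmetric] simp del: ln_le_cancel_iff)
    show "strict_antimono_on {0<..?m} (H2 \<alpha>)"
      by (rule strict_antimono_on_of_eq_minus_ln [where c = "ln ?m"]) (simp add: H2 m_pos)
    show "filterlim (H2 \<alpha>) at_top (at_right 0)"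
      by (rule filterlim_at_right_0_of_minus_ln_le [where c = "ln ?m"]) (simp add: H2)
    show "H2 \<alpha> ?m = 0"
      using H2 [OF m_pos] by simp
    show "strict_antimono_on {0<..} (H3 \<alpha>)" "filterlim (H3 \<alpha>) at_top (at_right 0)"
      "(H3 \<alpha> \<longlongrightarrow> 0) at_top"
      using H3_of_greater_1 [OF \<open>\<alpha> > 1\<close>] by blast+
  }
qed

end
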